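(* Let $k$ be a field of characteristic $p>0$ and let $n\ge1$ be an integer. Then: if $1\le n\le p$, then $\mathfrak{U}_{[1,n]}^E\leadsto\mathfrak{J}_{[1,n]}^E\leadsto(\mathfrak{J}_{[1,n]}^0)^E\cup(\mathfrak{J}_{[1,n]}^1)^E\leadsto(\mathfrak{J}_{[n,1]}^0)^E\cup(\mathfrak{J}_{[1,n]}^1)^E$; and if $n>p$, then $\mathfrak{J}_{[1,n]}^E=\emptyset$.
   Context: $k[T]$ is the polynomial ring in one variable. $A(T)\in\mathrm{Mat}(N,k[T])$ is exponential if $A(0)=I_N$ and $A(T)A(T')=A(T+T')$ ($T,T'$ indeterminates over $k$). For $S\subset\mathrm{Mat}(N,k[T])$, $S^E$ is the set of exponential matrices in $S$. For subsets $S,S'$ of $\mathrm{Mat}(N,k[T])$, $S\leadsto S'$ means: for every $A(T)\in S$ there is $P\in GL(N,k)$ with $P^{-1}A(T)P\in S'$. $\mathfrak{U}_{[1,n]}$ is the set of upper triangular matrices $(a_{i,j}(T))\in\mathrm{Mat}(n+1,k[T])$ with all diagonal entries $1$, $a_{1,2}(T)=0$, and $a_{i,i+1}(T)\ne0$ for $2\le i\le n$. $\nu_n\in\mathrm{Mat}(n,k)$ is the nilpotent matrix with entries $1$ at positions $(i,i+1)$, $1\le i\le n-1$, and $0$ elsewhere; $\boldsymbol{e}_1,\dots,\boldsymbol{e}_n$ are the standard column vectors of length $n$. For $n\ge2$: $\mathfrak{J}_{[1,n]}$ is the set of all matrices $\begin{pmatrix}1&u_n\,{}^t\boldsymbol{e}_n\\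 \boldsymbol{0}&I_n+\sum_{i=1}^{n-1}u_i\nu_n^i\end{pmatrix}\in GL(n+1,k[T])$ with $u_1,\dots,u_n\in k[T]$ and $u_1\ne0$; $\mathfrak{J}_{[1,n]}^0$ is the subset with $u_n=0$, and $\mathfrak{J}_{[1,n]}^1$ is the subset for which $u_1$ and $u_n$ are linearly independent over $k$. $\mathfrak{J}_{[n,1]}^0$ is the set of all matrices $\begin{pmatrix}I_n+\sum_{i=1}^{n-1}u_i\nu_n^i&\boldsymbol{0}\\ \boldsymbol{0}&1\end{pmatrix}$ with $u_1,\dots,u_{n-1}\in k[T]$, $u_1\ne0$. For $n=1$ the convention is $\mathfrak{J}_{[1,1]}=\mathfrak{J}_{[1,1]}^0=\{I_2\}$, $\mathfrak{J}_{[1,1]}^1=\emptyset$. *)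

theory Defs
  imports
    "Jordan_Normal_Form.Matrix"
    "HOL-Computational_Algebra.Polynomial"
begin

text \<open>Throughout, \<open>k[T]\<close> is \<open>'a poly\<close> and matrices of size \<open>N\<close> are elements of
  \<open>carrier_mat N N\<close>. Matrix indices start at 0, so the entry written \<open>(i, j)\<close> on paper is
  \<open>A $$ (i - 1, j - 1)\<close>.\<close>

definition GL :: "nat \<Rightarrow> 'a::comm_ring_1 mat set" where
  "GL N = {P \<in> carrier_mat N N. invertible_mat P}"

text \<open>The ring \<open>k[T, T']\<close> is represented by \<open>'a poly poly\<close>: the outer variable is \<open>T\<close>, and the
  coefficients are polynomials in the inner variable \<open>T'\<close>. The next three functions send
  \<open>f(T)\<close> to \<open>f(T)\<close>, \<open>f(T')\<close> and \<open>f(T + T')\<close> in this ring; the polynomial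
  \<open>[:[:0, 1:], 1:]\<close> is \<open>T' + T\<close>.\<close>

definition in_T :: "'a::comm_ring_1 poly \<Rightarrow> 'a poly poly" where
  "in_T f = map_poly (\<lambda>c. [:c:]) f"

definition in_T' :: "'a::comm_ring_1 poly \<Rightarrow> 'a poly poly" where
  "in_T' f = [:f:]"

definition in_sum :: "'a::comm_ring_1 poly \<Rightarrow> 'a poly poly" where
  "in_sum f = pcompose (in_T f) [:[:0, 1:], 1:]"

definition exponential :: "'a::comm_ring_1 poly mat \<Rightarrow> bool" where
  "exponential A \<longleftrightarrow> square_mat A \<and>
     map_mat (\<lambda>f. poly f 0) A = 1\<^sub>m (dim_row A) \<and>
     map_mat in_T A * map_mat in_T' A = map_mat in_sum A"

definition exp_part :: "'a::comm_ring_1 poly mat set \<Rightarrow> 'a poly mat set" where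
  "exp_part S = {A \<in> S. exponential A}"

text \<open>The relation between subsets \<open>S\<close>, \<open>S'\<close> of \<open>Mat(N, k[T])\<close>; here \<open>Q\<close> is the inverse of
  \<open>P\<close>, and \<open>\<lambda>c. [:c:]\<close> embeds \<open>k\<close> into \<open>k[T]\<close>.\<close>

definition leadsto :: "nat \<Rightarrow> 'a::field poly mat set \<Rightarrow> 'a poly mat set \<Rightarrow> bool" where
  "leadsto N S S' \<longleftrightarrow>
     (\<forall>A\<in>S. \<exists>P\<in>GL N. \<exists>Q\<in>carrier_mat N N. inverts_mat P Q \<and> inverts_mat Q P \<and>
        map_mat (\<lambda>c. [:c:]) Q * A * map_mat (\<lambda>c. [:c:]) P \<in> S')"

definition U1 :: "nat \<Rightarrow> 'a::comm_ring_1 poly mat set" where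
  "U1 n = {A \<in> carrier_mat (n + 1) (n + 1).
     upper_triangular A \<and> (\<forall>i < n + 1. A $$ (i, i) = 1) \<and>
     A $$ (0, 1) = 0 \<and> (\<forall>i\<in>{2..n}. A $$ (i - 1, i) \<noteq> 0)}"

definition nu :: "nat \<Rightarrow> 'a::comm_ring_1 mat" where
  "nu n = mat n n (\<lambda>(i, j). if j = i + 1 then 1 else 0)"

text \<open>The \<open>n \<times> n\<close> matrix \<open>I + (\<Sum>i = 1..n - 1. u\<^sub>i \<nu>\<^sup>i)\<close>.\<close>

definition jblock :: "nat \<Rightarrow> (nat \<Rightarrow> 'a::comm_ring_1 poly) \<Rightarrow> 'a poly mat" where
  "jblock n u = 1\<^sub>m n + finsum (module_mat TYPE('a poly) n n)
     (\<lambda>i. u i \<cdot>\<^sub>m map_mat (\<lambda>c. [:c:]) (nu n ^\<^sub>m i)) {1..n - 1}"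

text \<open>\<open>jmat_1n n u\<close> has blocks of sizes \<open>1\<close> and \<open>n\<close>, \<open>jmat_n1 n u\<close> of sizes \<open>n\<close> and \<open>1\<close>. Only
  \<open>u 1, \<dots>, u n\<close> (respectively \<open>u 1, \<dots>, u (n - 1)\<close>) occur in them.\<close>

definition jmat_1n :: "nat \<Rightarrow> (nat \<Rightarrow> 'a::comm_ring_1 poly) \<Rightarrow> 'a poly mat" where
  "jmat_1n n u = four_block_mat
     (1\<^sub>m 1)    (u n \<cdot>\<^sub>m mat_of_row (unit_vec n (n - 1)))
     (0\<^sub>m n 1)  (jblock n u)"

definition jmat_n1 :: "nat \<Rightarrow> (nat \<Rightarrow> 'a::comm_ring_1 poly) \<Rightarrow> 'a poly mat" where
  "jmat_n1 n u = four_block_mat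
     (jblock n u)  (0\<^sub>m n 1)
     (0\<^sub>m 1 n)      (1\<^sub>m 1)"

text \<open>The value at \<open>n = 1\<close> is a convention in each of the following four definitions.\<close>

definition J1n :: "nat \<Rightarrow> 'a::field poly mat set" where
  "J1n n = (if n = 1 then {1\<^sub>m 2} else
     {jmat_1n n u | u. jmat_1n n u \<in> GL (n + 1) \<and> u 1 \<noteq> 0})"

definition J1n_0 :: "nat \<Rightarrow> 'a::field poly mat set" where
  "J1n_0 n = (if n = 1 then {1\<^sub>m 2} else
     {jmat_1n n u | u. jmat_1n n u \<in> GL (n + 1) \<and> u 1 \<noteq> 0 \<and> u n = 0})"

text \<open>Linear independence over \<open>k\<close> is that of the family \<open>(u 1, u n)\<close>, not of the set
  \<open>{u 1, u n}\<close>, which would be a singleton if \<open>u 1 = u n\<close>.\<close>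

definition J1n_1 :: "nat \<Rightarrow> 'a::field poly mat set" where
  "J1n_1 n = (if n = 1 then {} else
     {jmat_1n n u | u. jmat_1n n u \<in> GL (n + 1) \<and> u 1 \<noteq> 0 \<and>
        (\<forall>a b. smult a (u 1) + smult b (u n) = 0 \<longrightarrow> a = 0 \<and> b = 0)})"

definition Jn1_0 :: "nat \<Rightarrow> 'a::field poly mat set" where
  "Jn1_0 n = (if n = 1 then {1\<^sub>m 2} else {jmat_n1 n u | u. u 1 \<noteq> 0})"

end

theory Submission
  imports Defs "Jordan_Normal_Form.Column_Operations"
    "Jordan_Normal_Form.Determinant"
begin

text \<open>Expanding \<open>A(T) = \<Sum> A\<^sub>m T\<^sup>m\<close>, exponentiality says that \<open>A\<^sub>0 = I\<close> and that
  \<open>A\<^sub>l A\<^sub>m\<close> is \<open>A\<^sub>l\<^sub>+\<^sub>m\<close> times a binomial coefficient; in particular the \<open>A\<^sub>m\<close> commute. For \<open>A\<close> in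
  \<open>\<UU>\<^bsub>[1,n]\<^esub>\<close>, commutation makes the superdiagonal entries proportional, so some \<open>A\<^sub>m\<close> has all of them
  nonzero and is similar to \<open>diag(0, \<nu>)\<close>. The commutant of \<open>diag(0, \<nu>)\<close> yields the shape
  \<open>\<JJ>\<^bsub>[1,n]\<^esub>\<close>. If \<open>n > p\<close>, then the \<open>p\<close>-th power of a coefficient matrix with nonzero
  superdiagonal is nonzero, although it is a multiple of \<open>binomial (pm) m\<close>, which \<open>p\<close> divides.\<close>

section \<open>Exponential matrices in terms of their coefficients\<close>

lemma index_mult_mat_sum:
  assumes "A \<in> carrier_mat n m" "B \<in> carrier_mat m k" "i < n" "j < k"
  shows "(A * B) $$ (i, j) = (\<Sum>l<m. A $$ (i, l) * B $$ (l, j))"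
  using assms by (auto simp: scalar_prod_def lessThan_atLeast0 intro!: sum.cong)

lemma pow_mat_Suc_left:
  fixes A :: "'a::comm_ring_1 mat"
  assumes A: "A \<in> carrier_mat n n"
  shows "A ^\<^sub>m Suc k = A * A ^\<^sub>m k"
proof (induction k)
  case 0
  then show ?case using A by simp
next
  case (Suc k)
  have "A ^\<^sub>m Suc (Suc k) = (A * A ^\<^sub>m k) * A" using Suc by simp
  also have "\<dots> = A * A ^\<^sub>m Suc k"
    using A by (simp add: assoc_mult_mat[of _ n n _ n _ n])
  finally show ?case .
qed

abbreviation const_mat :: "'a::comm_ring_1 mat \<Rightarrow> 'a poly mat" where
  "const_mat \<equiv> map_mat (\<lambda>c. [:c:])"

definition coeff_mat :: "nat \<Rightarrow> 'a::comm_ring_1 poly mat \<Rightarrow> 'a mat" where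
  "coeff_mat m A = map_mat (\<lambda>f. coeff f m) A"

lemma coeff_mat_carrier [simp]: "A \<in> carrier_mat r c \<Longrightarrow> coeff_mat m A \<in> carrier_mat r c"
  by (simp add: coeff_mat_def)

lemma index_coeff_mat [simp]:
  "i < dim_row A \<Longrightarrow> j < dim_col A \<Longrightarrow> coeff_mat m A $$ (i, j) = coeff (A $$ (i, j)) m"
  "dim_row (coeff_mat m A) = dim_row A" "dim_col (coeff_mat m A) = dim_col A"
  by (simp_all add: coeff_mat_def)

text \<open>A constant matrix has no \<open>T\<close> in its entries, so multiplying by it on either
  side acts on each power of \<open>T\<close> separately.\<close>

lemma coeff_mat_conj:
  assumes "Q \<in> carrier_mat N N" "A \<in> carrier_mat N N" "P \<in> carrier_mat N N"
  shows "coeff_mat m (const_mat Q * A * const_mat P) = Q * coeff_mat m A * P"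
proof -
  have l: "coeff_mat m (const_mat Q * B) = Q * coeff_mat m B" if "B \<in> carrier_mat N N" for B
    using assms that
    by (intro eq_matI) (auto simp: scalar_prod_def coeff_sum intro!: sum.cong)
  have r: "coeff_mat m (B * const_mat P) = coeff_mat m B * P" if "B \<in> carrier_mat N N" for B
    using assms that
    by (intro eq_matI) (auto simp: scalar_prod_def coeff_sum intro!: sum.cong)
  show ?thesis using assms by (subst r) (auto simp: l)
qed

text \<open>\<open>in_T' g\<close> is constant in the outer variable and the coefficients of
  \<open>in_T f\<close> are constant in the inner one, so the product has a single term at each
  monomial.\<close>

lemma coeff_in_T_times_in_T':
  "coeff (coeff (in_T f * in_T' g) l) m = coeff f l * coeff g m"
proof -
  have "in_T f * in_T' g = smult g (in_T f)"
    by (simp add: in_T'_def)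
  then show ?thesis
    by (simp add: in_T_def coeff_map_poly mult.commute)
qed

text \<open>This is the binomial theorem in disguise: replacing \<open>f\<close> by
  \<open>a + T f\<close> turns \<open>in_sum f\<close> into \<open>a + (T + T') in_sum f\<close>,
  and the induction step becomes Pascal's rule.\<close>

lemma coeff_in_sum:
  "coeff (coeff (in_sum f) l) m = of_nat ((l + m) choose l) * coeff f (l + m)"
proof (induction f arbitrary: l m)
  case 0
  then show ?case by (simp add: in_sum_def in_T_def)
next
  case (pCons a f)
  have "in_T (pCons a f) = pCons [:a:] (in_T f)"
    by (intro poly_eqI) (simp add: in_T_def coeff_map_poly coeff_pCons split: nat.split)
  then have eq: "in_sum (pCons a f) = [:[:a:]:] + [:[:0, 1:], 1:] * in_sum f"
    by (simp add: in_sum_def pcompose_pCons)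
  show ?case
    by (cases l; cases m)
      (simp_all add: eq pCons.IH coeff_pCons algebra_simps split: nat.splits)
qed

text \<open>Both sides of the functional equation are compared at the monomial
  \<open>T^l T'^m\<close>. This replaces an identity over \<open>k[T, T']\<close> by relations
  between matrices over \<open>k\<close>, on which all later arguments rest.\<close>

lemma exponential_iff_coeff_mat:
  assumes A: "A \<in> carrier_mat N N"
  shows "exponential A \<longleftrightarrow> coeff_mat 0 A = 1\<^sub>m N \<and>
    (\<forall>l m. coeff_mat l A * coeff_mat m A = of_nat ((l + m) choose l) \<cdot>\<^sub>m coeff_mat (l + m) A)"
proof -
  have entry: "coeff (coeff ((map_mat in_T A * map_mat in_T' A) $$ (i, j)) l) m
      = (coeff_mat l A * coeff_mat m A) $$ (i, j)" if "i < N" "j < N" for i j l m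
    using A that
    by (simp add: index_mult_mat_sum[of _ N N _ N] coeff_sum coeff_in_T_times_in_T'
        del: index_mult_mat(1))
  have "map_mat in_T A * map_mat in_T' A = map_mat in_sum A \<longleftrightarrow>
    (\<forall>i<N. \<forall>j<N. \<forall>l m. coeff (coeff ((map_mat in_T A * map_mat in_T' A) $$ (i, j)) l) m
      = coeff (coeff (in_sum (A $$ (i, j))) l) m)"
    using A by (auto simp: mat_eq_iff poly_eq_iff simp del: index_mult_mat(1))
  also have "\<dots> \<longleftrightarrow> (\<forall>l m. coeff_mat l A * coeff_mat m A
      = of_nat ((l + m) choose l) \<cdot>\<^sub>m coeff_mat (l + m) A)"
    using A by (auto simp: mat_eq_iff entry coeff_in_sum simp del: index_mult_mat(1))
  finally show ?thesis
    using A by (simp add: exponential_def poly_0_coeff_0 coeff_mat_def)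
qed

text \<open>The coefficient relations are multiplicative, and \<open>X\<close> to
  \<open>Q X P\<close> respects products because the inner factor \<open>P Q\<close>
  cancels.\<close>

lemma exponential_conj:
  assumes exp: "exponential A"
    and car: "A \<in> carrier_mat N N" "P \<in> carrier_mat N N" "Q \<in> carrier_mat N N"
    and inv: "P * Q = 1\<^sub>m N" "Q * P = 1\<^sub>m N"
  shows "exponential (const_mat Q * A * const_mat P)"
proof -
  have "Q * X * P * (Q * Y * P) = Q * (X * Y) * P"
    if "X \<in> carrier_mat N N" "Y \<in> carrier_mat N N" for X Y
  proof -
    have "Q * X * P * (Q * Y * P) = Q * X * (P * Q) * (Y * P)"
      using car that by (simp add: assoc_mult_mat[of _ N N _ N _ N])
    then show ?thesis using car that inv by (simp add: assoc_mult_mat[of _ N N _ N _ N])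
  qed
  moreover have "coeff_mat 0 A = 1\<^sub>m N" and
    "coeff_mat l A * coeff_mat m A = of_nat ((l + m) choose l) \<cdot>\<^sub>m coeff_mat (l + m) A" for l m
    using exp car by (auto simp: exponential_iff_coeff_mat[of _ N])
  ultimately show ?thesis
    unfolding exponential_iff_coeff_mat[OF mult_carrier_mat[OF mult_carrier_mat[OF
        map_carrier_mat[THEN iffD2, OF car(3)] car(1)] map_carrier_mat[THEN iffD2, OF car(2)]]]
    using car inv by (simp only: coeff_mat_conj coeff_mat_carrier)
      (simp add: mult_smult_distrib[of _ N N _ N] mult_smult_assoc_mat[of _ N N _ N])
qed

text \<open>The binomial coefficient in the product relation is symmetric in \<open>l\<close> and
  \<open>m\<close>.\<close>

lemma coeff_mat_commute:
  assumes "exponential A" "A \<in> carrier_mat N N"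
  shows "coeff_mat l A * coeff_mat m A = coeff_mat m A * coeff_mat l A"
  using assms binomial_symmetric[of l "l + m"]
  by (simp add: exponential_iff_coeff_mat[of _ N] add.commute)

lemma coeff_mat_pow:
  assumes "exponential A" "A \<in> carrier_mat N N"
  shows "coeff_mat l A ^\<^sub>m k = of_nat (\<Prod>j=1..k. (j * l) choose l) \<cdot>\<^sub>m coeff_mat (k * l) A"
proof (induction k)
  case 0
  then show ?case using assms by (simp add: exponential_iff_coeff_mat[of _ N] mat_eq_iff)
next
  case (Suc k)
  \<comment> \<open>The factors are swapped so that the product relation produces the binomial
    coefficient over \<open>l\<close>, as the formula requires, rather than over
    \<open>k * l\<close>.\<close>
  have "coeff_mat (k * l) A * coeff_mat l A = coeff_mat l A * coeff_mat (k * l) A"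
    using assms by (rule coeff_mat_commute)
  also have "\<dots> = of_nat ((l + k * l) choose l) \<cdot>\<^sub>m coeff_mat (l + k * l) A"
    using assms by (simp add: exponential_iff_coeff_mat[of _ N])
  finally show ?case
    using assms Suc by (simp add: mult_smult_assoc_mat[of _ N N _ N])
      (auto intro!: eq_matI simp: mult.assoc)
qed

lemma dvd_binomial_mult:
  assumes "(m::nat) > 0"
  shows "p dvd ((p * m) choose m)"
proof -
  have "m * ((p * m) choose m) = p * m * ((p * m - 1) choose (m - 1))"
    using assms by (rule times_binomial_minus1_eq)
  then have "(p * m) choose m = p * ((p * m - 1) choose (m - 1))"
    using assms by simp
  then show ?thesis by simp
qed

text \<open>In the scalar of \<open>coeff_mat_pow\<close> the factor with
  \<open>j = CHAR('a)\<close> is divisible by the characteristic.\<close>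

lemma coeff_mat_pow_char:
  fixes A :: "'a::comm_ring_1 poly mat"
  assumes "exponential A" "A \<in> carrier_mat N N" "m > 0" "CHAR('a) > 0"
  shows "coeff_mat m A ^\<^sub>m CHAR('a) = 0\<^sub>m N N"
proof -
  have "CHAR('a) dvd (\<Prod>j=1..CHAR('a). (j * m) choose m)"
    using assms dvd_binomial_mult[of m "CHAR('a)"] by (intro dvd_trans[OF _ dvd_prodI[of _ "CHAR('a)"]]) auto
  then have "of_nat (\<Prod>j=1..CHAR('a). (j * m) choose m) = (0::'a)"
    by (simp only: of_nat_eq_0_iff_char_dvd)
  then show ?thesis
    using assms by (simp add: coeff_mat_pow[of _ N] del: of_nat_prod) (auto intro!: eq_matI)
qed

section \<open>Strictly upper triangular matrices\<close>

definition strict_upper :: "'a::zero mat \<Rightarrow> bool" where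
  "strict_upper M \<longleftrightarrow> (\<forall>i<dim_row M. \<forall>j\<le>i. j < dim_col M \<longrightarrow> M $$ (i, j) = 0)"

lemma strict_upperD:
  "strict_upper M \<Longrightarrow> M \<in> carrier_mat N N \<Longrightarrow> i < N \<Longrightarrow> j \<le> i \<Longrightarrow> M $$ (i, j) = 0"
  by (auto simp: strict_upper_def)

text \<open>Every factor \<open>M\<close> moves the column index at least one place to the right of
  the row index, so \<open>k\<close> factors move it at least \<open>k\<close> places.\<close>

lemma strict_upper_pow_eq_0:
  fixes M :: "'a::comm_ring_1 mat"
  assumes M: "M \<in> carrier_mat N N" "strict_upper M" and "i < N" "j < N" "j < i + k"
  shows "(M ^\<^sub>m k) $$ (i, j) = 0"
  using assms(3-)
proof (induction k arbitrary: j)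
  case 0
  then show ?case using M by simp
next
  case (Suc k)
  have "(M ^\<^sub>m k) $$ (i, l) * M $$ (l, j) = 0" if "l < N" for l
    using Suc that strict_upperD[OF M(2,1), of l j] by (cases "l < i + k") auto
  then show ?case
    using M Suc.prems by (simp add: index_mult_mat_sum[of _ N N _ N] del: index_mult_mat(1))
qed

text \<open>Going from \<open>i\<close> to \<open>i + k\<close> in \<open>k\<close> strictly
  increasing steps is possible in one way only, through every intermediate index.\<close>

lemma strict_upper_pow_diag:
  fixes M :: "'a::comm_ring_1 mat"
  assumes M: "M \<in> carrier_mat N N" "strict_upper M" and "i + k < N"
  shows "(M ^\<^sub>m k) $$ (i, i + k) = (\<Prod>l<k. M $$ (i + l, i + l + 1))"
  using assms(3-)
proof (induction k)
  case 0
  then show ?case using M by simp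
next
  case (Suc k)
  have "(M ^\<^sub>m k) $$ (i, l) * M $$ (l, i + Suc k)
      = (if l = i + k then (\<Prod>l<k. M $$ (i + l, i + l + 1)) * M $$ (i + k, i + k + 1) else 0)"
    if "l < N" for l
    using Suc that strict_upperD[OF M(2,1), of l "i + Suc k"]
      strict_upper_pow_eq_0[OF M, of i l k]
    by (cases l "i + k" rule: linorder_cases) auto
  then show ?case
    using M Suc.prems by (simp add: index_mult_mat_sum[of _ N N _ N] del: index_mult_mat(1))
qed

text \<open>Only the middle index \<open>i + 1\<close> contributes. Applied to both orders of a
  commuting product, this relates neighbouring superdiagonal entries.\<close>

lemma strict_upper_mult_second_diag:
  fixes X :: "'a::comm_ring_1 mat"
  assumes X: "X \<in> carrier_mat N N" "strict_upper X" and Y: "Y \<in> carrier_mat N N" "strict_upper Y"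
    and i: "i + 2 < N"
  shows "(X * Y) $$ (i, i + 2) = X $$ (i, i + 1) * Y $$ (i + 1, i + 2)"
proof -
  have "X $$ (i, l) * Y $$ (l, i + 2)
      = (if l = i + 1 then X $$ (i, i + 1) * Y $$ (i + 1, i + 2) else 0)" if "l < N" for l
  proof -
    consider "l \<le> i" | "l = i + 1" | "i + 2 \<le> l" by linarith
    then show ?thesis
      using that i strict_upperD[OF X(2,1), of i l] strict_upperD[OF Y(2,1), of l "i + 2"]
      by cases simp_all
  qed
  then have "(\<Sum>l<N. X $$ (i, l) * Y $$ (l, i + 2))
      = (\<Sum>l<N. if l = i + 1 then X $$ (i, i + 1) * Y $$ (i + 1, i + 2) else 0)"
    by (intro sum.cong) auto
  then show ?thesis
    using i by (simp only: index_mult_mat_sum[OF X(1) Y(1)] sum.delta) simp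
qed

lemma upper_triangular_inverse:
  fixes P :: "'a::field mat"
  assumes P: "P \<in> carrier_mat N N" "upper_triangular P" and diag: "\<And>i. i < N \<Longrightarrow> P $$ (i, i) \<noteq> 0"
  obtains Q where "Q \<in> carrier_mat N N" "P * Q = 1\<^sub>m N" "Q * P = 1\<^sub>m N"
proof -
  have "det P \<noteq> 0"
    using P diag by (subst det_upper_triangular[OF P(2,1)]) (auto simp: diag_mat_def prod_list_zero_iff)
  from det_non_zero_imp_unit[OF P(1) this, of "()"] show ?thesis
    using that by (auto simp: Units_def ring_mat_def)
qed

text \<open>The matrix \<open>diag(0, \<nu>\<^sub>n)\<close>.\<close>

definition shift_mat :: "nat \<Rightarrow> 'a::comm_ring_1 mat" where
  "shift_mat n = mat (n + 1) (n + 1) (\<lambda>(i, j). if i \<ge> 1 \<and> j = i + 1 then 1 else 0)"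

lemma shift_mat_carrier [simp]: "shift_mat n \<in> carrier_mat (Suc n) (Suc n)"
  by (simp add: shift_mat_def)

lemma mult_shift_mat:
  assumes "X \<in> carrier_mat (n + 1) (n + 1)" "i \<le> n" "j \<le> n"
  shows "(X * shift_mat n) $$ (i, j) = (if j \<ge> 2 then X $$ (i, j - 1) else 0)"
proof -
  have "(X * shift_mat n) $$ (i, j) = (\<Sum>l<n+1. X $$ (i, l) * shift_mat n $$ (l, j))"
    using assms by (intro index_mult_mat_sum[where n = "n + 1" and k = "n + 1"]) auto
  \<comment> \<open>For \<open>j = 0\<close> the truncated index \<open>j - 1\<close> is 0, which is
    harmless because the value there is 0.\<close>
  also have "\<dots> = (\<Sum>l<n+1. if l = j - 1 then (if j \<ge> 2 then X $$ (i, j - 1) else 0) else 0)"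
    using assms by (intro sum.cong) (auto simp: shift_mat_def)
  finally show ?thesis using assms by auto
qed

lemma shift_mat_mult:
  assumes "X \<in> carrier_mat (n + 1) (n + 1)" "i \<le> n" "j \<le> n"
  shows "(shift_mat n * X) $$ (i, j) = (if i \<ge> 1 \<and> i < n then X $$ (i + 1, j) else 0)"
proof -
  have "(shift_mat n * X) $$ (i, j) = (\<Sum>l<n+1. shift_mat n $$ (i, l) * X $$ (l, j))"
    using assms by (intro index_mult_mat_sum[where n = "n + 1" and k = "n + 1"]) auto
  also have "\<dots> = (\<Sum>l<n+1. if l = i + 1 then (if i \<ge> 1 then X $$ (i + 1, j) else 0) else 0)"
    using assms by (intro sum.cong) (auto simp: shift_mat_def)
  finally show ?thesis using assms by auto
qed

text \<open>Row \<open>i + 1\<close> is row \<open>i\<close> moved one place to the right, which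
  gives a Toeplitz block, and row 0 must vanish between the columns 0 and \<open>n\<close>. The
  hypotheses on columns 0 and 1 remove what else the commutant of diag(0, nu) contains: two entries
  of column 0 and the multiples of the identity in the block.\<close>

lemma shift_mat_commutant:
  assumes X: "X \<in> carrier_mat (n + 1) (n + 1)" and n: "n \<ge> 1"
    and comm: "X * shift_mat n = shift_mat n * X"
    and col: "\<And>i. i \<le> n \<Longrightarrow> X $$ (i, 0) = 0" "\<And>i. i \<le> n \<Longrightarrow> X $$ (i, 1) = 0"
    and ij: "i \<le> n" "j \<le> n"
  shows "X $$ (i, j) = (if i = 0 then if j = n then X $$ (0, n) else 0
    else if i < j then X $$ (1, j - i + 1) else 0)"
proof -
  have eq: "(if j \<ge> 2 then X $$ (i, j - 1) else 0) = (if i \<ge> 1 \<and> i < n then X $$ (i + 1, j) else 0)"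
    if "i \<le> n" "j \<le> n" for i j
    using mult_shift_mat[OF X that] shift_mat_mult[OF X that] comm by simp
  show ?thesis
  proof (cases "i = 0")
    case True
    have "X $$ (0, j) = 0" if "j < n"
      using that eq[of 0 "j + 1"] col n by (cases "j = 0") auto
    then show ?thesis using True ij by auto
  next
    case False
    then have "i \<ge> 1" by simp
    then show ?thesis using ij
    proof (induction i arbitrary: j rule: dec_induct)
      case base
      then show ?case using col[of 1] n by (cases j "1 :: nat" rule: linorder_cases) auto
    next
      case (step i)
      show ?case
      proof (cases "j \<ge> 2")
        case True
        then have "X $$ (Suc i, j) = X $$ (i, j - 1)"
          using eq[of i j] step by auto
        then show ?thesis
          using step True by (auto simp: Suc_diff_le)
      next
        case False
        then have "j = 0 \<or> j = 1" by auto
        then show ?thesis using col step by auto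
      qed
    qed
  qed
qed

text \<open>The new basis is \<open>e\<^sub>0, M\<^sup>n\<^sup>-\<^sup>1 e\<^sub>n, \<dots>, M e\<^sub>n, e\<^sub>n\<close>.\<close>

lemma strict_upper_similar_shift_mat:
  fixes M :: "'a::field mat"
  assumes n: "n \<ge> 1" and M: "M \<in> carrier_mat (n + 1) (n + 1)" "strict_upper M" "M $$ (0, 1) = 0"
    and sup: "\<And>i. i \<in> {1..<n} \<Longrightarrow> M $$ (i, i + 1) \<noteq> 0"
  obtains P Q where "P \<in> carrier_mat (n + 1) (n + 1)" "Q \<in> carrier_mat (n + 1) (n + 1)"
    "P * Q = 1\<^sub>m (n + 1)" "Q * P = 1\<^sub>m (n + 1)" "upper_triangular P"
    "Q * M * P = shift_mat n"
proof -
  define P where "P = mat (n + 1) (n + 1)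
    (\<lambda>(i, j). if j = 0 then if i = 0 then 1 else 0 else (M ^\<^sub>m (n - j)) $$ (i, n))"
  have P: "P \<in> carrier_mat (n + 1) (n + 1)" by (simp add: P_def)
  have up: "upper_triangular P"
    using strict_upper_pow_eq_0[OF M(1,2)] by (auto simp: P_def)
  have diag: "P $$ (i, i) \<noteq> 0" if "i < n + 1" for i
  proof (cases "i = 0")
    case False
    then have "(M ^\<^sub>m (n - i)) $$ (i, n) = (\<Prod>l<n-i. M $$ (i + l, i + l + 1))"
      using strict_upper_pow_diag[OF M(1,2), of i "n - i"] that by simp
    also have "\<dots> \<noteq> 0" using sup False by auto
    finally show ?thesis using False that by (simp add: P_def)
  qed (simp add: P_def)
  obtain Q where Q: "Q \<in> carrier_mat (n + 1) (n + 1)" "P * Q = 1\<^sub>m (n + 1)" "Q * P = 1\<^sub>m (n + 1)"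
    using upper_triangular_inverse[OF P up diag] by blast
  \<comment> \<open>\<open>M\<close> sends column \<open>j\<close> of \<open>P\<close> to column
    \<open>j - 1\<close> for \<open>j \<ge> 2\<close>. It remains to see that it kills column 0,
    which is clear, and column 1, which amounts to \<open>M^n e_n = 0\<close>.\<close>
  have "M * P = P * shift_mat n"
  proof (rule eq_matI)
    fix i j assume "i < dim_row (P * shift_mat n)" "j < dim_col (P * shift_mat n)"
    then have ij: "i \<le> n" "j \<le> n" using P by (auto simp: shift_mat_def)
    have MP: "(M * P) $$ (i, j) = (\<Sum>l<n+1. M $$ (i, l) * P $$ (l, j))"
      using M P ij by (intro index_mult_mat_sum) auto
    show "(M * P) $$ (i, j) = (P * shift_mat n) $$ (i, j)"
    proof (cases "j = 0")
      case True
      then have "M $$ (i, l) * P $$ (l, j) = 0" if "l < n + 1" for l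
        using that ij strict_upperD[OF M(2,1), of i 0] by (cases "l = 0") (auto simp: P_def)
      then have "(M * P) $$ (i, j) = 0" unfolding MP by (intro sum.neutral) simp
      then show ?thesis using ij True by (simp only: mult_shift_mat[OF P]) simp
    next
      case False
      have "(M * P) $$ (i, j) = (\<Sum>l<n+1. M $$ (i, l) * (M ^\<^sub>m (n - j)) $$ (l, n))"
        unfolding MP using False ij by (intro sum.cong) (auto simp: P_def)
      also have "\<dots> = (M * M ^\<^sub>m (n - j)) $$ (i, n)"
        using M ij by (intro index_mult_mat_sum[symmetric]) auto
      also have "\<dots> = (M ^\<^sub>m (n - (j - 1))) $$ (i, n)"
        using ij False pow_mat_Suc_left[OF M(1), of "n - j"] by (simp add: Suc_diff_le)
      also have "\<dots> = (if j \<ge> 2 then P $$ (i, j - 1) else 0)"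
      proof (cases "j \<ge> 2")
        case True
        then show ?thesis using ij by (simp add: P_def)
      next
        case j: False
        \<comment> \<open>By strictness only row 0 is in question, and the entry there is the
          product of all superdiagonal entries, among them \<open>M $$ (0, 1) = 0\<close>.\<close>
        have "(M ^\<^sub>m n) $$ (i, n) = 0"
        proof (cases "i = 0")
          case True
          then have "(M ^\<^sub>m n) $$ (i, n) = (\<Prod>l<n. M $$ (l, l + 1))"
            using strict_upper_pow_diag[OF M(1,2), of 0 n] by simp
          also have "\<dots> = 0" using n M(3) by (intro prod_zero) (auto intro!: bexI[of _ 0])
          finally show ?thesis .
        next
          case False
          then show ?thesis using ij strict_upper_pow_eq_0[OF M(1,2), of i n n] by simp
        qed
        then show ?thesis using j False ij by (simp add: not_le)
      qed
      finally show ?thesis using ij by (simp only: mult_shift_mat[OF P])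
    qed
  qed (use M P in \<open>auto simp: shift_mat_def\<close>)
  then have "Q * M * P = Q * (P * shift_mat n)"
    using Q P M by (simp add: assoc_mult_mat[of _ "n+1" "n+1" _ "n+1" _ "n+1"])
  also have "\<dots> = (Q * P) * shift_mat n"
    using Q P by (intro assoc_mult_mat[symmetric, of _ "n+1" "n+1" _ "n+1" _ "n+1"]) auto
  also have "\<dots> = shift_mat n"
    using Q by (simp add: left_mult_one_mat[of _ "Suc n" "Suc n"])
  finally show ?thesis using that P Q up by blast
qed

section \<open>Entries of the normal forms\<close>

lemma index_finsum_mat:
  fixes vs :: "'b \<Rightarrow> 'a::comm_ring_1 mat"
  assumes "finite F" "vs \<in> F \<rightarrow> carrier_mat nr nc" and ij: "i < nr" "j < nc"
  shows "finsum (module_mat TYPE('a) nr nc) vs F $$ (i, j) = (\<Sum>f\<in>F. vs f $$ (i, j))"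
proof -
  interpret abelian_group "module_mat TYPE('a) nr nc" by (rule abelian_group_mat)
  show ?thesis
    using assms(1,2)
  proof (induction F)
    case empty
    then show ?case using ij by (simp add: module_mat_simps)
  next
    case (insert f F)
    then have vs: "vs \<in> F \<rightarrow> carrier (module_mat TYPE('a) nr nc)"
      "vs f \<in> carrier (module_mat TYPE('a) nr nc)"
      by (auto simp: module_mat_simps)
    have "finsum (module_mat TYPE('a) nr nc) vs F \<in> carrier_mat nr nc"
      using finsum_closed[OF vs(1)] by (simp add: module_mat_simps)
    then show ?case
      using insert ij by (simp add: finsum_insert[OF insert(1,2) vs] module_mat_simps)
  qed
qed

lemma nu_pow: "(nu n :: 'a::comm_ring_1 mat) ^\<^sub>m k = mat n n (\<lambda>(i, j). if j = i + k then 1 else 0)"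
proof (induction k)
  case 0
  then show ?case by (auto simp: nu_def intro!: eq_matI)
next
  case (Suc k)
  show ?case
  proof (rule eq_matI, goal_cases)
    case (1 i j)
    then have ij: "i < n" "j < n" by auto
    have nu: "(nu n :: 'a mat) $$ (l, j) = (if j = l + 1 then 1 else 0)" if "l < n" for l
      using that ij by (simp add: nu_def)
    have "((nu n :: 'a mat) ^\<^sub>m Suc k) $$ (i, j) = (\<Sum>l<n. (nu n ^\<^sub>m k) $$ (i, l) * nu n $$ (l, j))"
      using ij by (simp only: pow_mat.simps, intro index_mult_mat_sum) (auto simp: nu_def)
    also have "\<dots> = (\<Sum>l<n. if l = i + k then if j = i + Suc k then 1 else 0 else 0)"
      by (intro sum.cong) (use ij in \<open>auto simp: Suc nu\<close>)
    finally show ?case using ij by auto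
  qed (auto simp: nu_def)
qed

lemma jblock_carrier [simp]: "jblock n u \<in> carrier_mat n n"
proof -
  interpret abelian_group "module_mat TYPE('a poly) n n" by (rule abelian_group_mat)
  have "finsum (module_mat TYPE('a poly) n n) (\<lambda>i. u i \<cdot>\<^sub>m const_mat (nu n ^\<^sub>m i)) {1..n - 1}
    \<in> carrier (module_mat TYPE('a poly) n n)"
    by (rule finsum_closed) (auto simp: module_mat_simps nu_pow)
  then show ?thesis by (simp add: jblock_def module_mat_simps)
qed

lemma dim_jblock [simp]: "dim_row (jblock n u) = n" "dim_col (jblock n u) = n"
  using jblock_carrier by blast+

lemma index_jblock [simp]:
  assumes "i < n" "j < n"
  shows "jblock n u $$ (i, j) = (if i = j then 1 else if i < j then u (j - i) else 0)"
proof -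
  let ?S = "finsum (module_mat TYPE('a poly) n n) (\<lambda>i. u i \<cdot>\<^sub>m const_mat (nu n ^\<^sub>m i)) {1..n - 1}"
  have "?S $$ (i, j) = (\<Sum>k\<in>{1..n - 1}. (u k \<cdot>\<^sub>m const_mat (nu n ^\<^sub>m k)) $$ (i, j))"
    using assms by (intro index_finsum_mat) (auto simp: nu_pow)
  \<comment> \<open>Only one power of \<open>nu n\<close> has a nonzero entry at
    \<open>(i, j)\<close>. If \<open>j \<le> i\<close>, the truncated \<open>j - i\<close> is 0 and
    lies outside the range of summation.\<close>
  also have "\<dots> = (\<Sum>k\<in>{1..n - 1}. if k = j - i then if i < j then u (j - i) else 0 else 0)"
    using assms by (intro sum.cong) (auto simp: nu_pow)
  also have "\<dots> = (if i < j then u (j - i) else 0)"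
    using assms by auto
  finally have S: "?S $$ (i, j) = (if i < j then u (j - i) else 0)" .
  interpret abelian_group "module_mat TYPE('a poly) n n" by (rule abelian_group_mat)
  have "?S \<in> carrier (module_mat TYPE('a poly) n n)"
    by (rule finsum_closed) (auto simp: module_mat_simps nu_pow)
  then show ?thesis using assms S by (simp add: jblock_def module_mat_simps)
qed

lemma jmat_1n_carrier [simp]: "jmat_1n n u \<in> carrier_mat (Suc n) (Suc n)"
  unfolding jmat_1n_def
  using four_block_carrier_mat[OF one_carrier_mat[of 1] jblock_carrier[of n u]] by simp

lemma jmat_n1_carrier [simp]: "jmat_n1 n u \<in> carrier_mat (Suc n) (Suc n)"
  unfolding jmat_n1_def
  using four_block_carrier_mat[OF jblock_carrier[of n u] one_carrier_mat[of 1]] by simp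

lemma dim_jmat_1n [simp]: "dim_row (jmat_1n n u) = Suc n" "dim_col (jmat_1n n u) = Suc n"
  using jmat_1n_carrier by blast+

lemma dim_jmat_n1 [simp]: "dim_row (jmat_n1 n u) = Suc n" "dim_col (jmat_n1 n u) = Suc n"
  using jmat_n1_carrier by blast+

lemma index_jmat_1n:
  assumes "i \<le> n" "j \<le> n"
  shows "jmat_1n n u $$ (i, j) = (if i = j then 1 else
    if i = 0 then if j = n then u n else 0 else if i < j \<and> 0 < j then u (j - i) else 0)"
  using assms by (auto simp: jmat_1n_def mat_of_row_def)

lemma index_jmat_n1:
  assumes "i \<le> n" "j \<le> n"
  shows "jmat_n1 n u $$ (i, j) = (if i = j then 1 else if i < j \<and> j < n then u (j - i) else 0)"
proof -
  consider "i < n" "j < n" | "i < n" "j = n" | "i = n" "j < n" | "i = n" "j = n"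
    using assms by linarith
  then show ?thesis by cases (simp_all add: jmat_n1_def)
qed

text \<open>Determinant 1 makes the adjugate a two-sided inverse, so no division takes place and the
  entries may be polynomials.\<close>

lemma upper_unitriangular_in_GL:
  assumes A: "A \<in> carrier_mat N N" "upper_triangular A" "\<And>i. i < N \<Longrightarrow> A $$ (i, i) = 1"
  shows "A \<in> GL N"
proof -
  have "diag_mat A = map (\<lambda>_. 1) [0..<N]"
    using A by (auto simp: diag_mat_def)
  then have "det A = 1"
    by (simp add: det_upper_triangular[OF A(2,1)] map_replicate_const)
  then have "A * adj_mat A = 1\<^sub>m N" "adj_mat A * A = 1\<^sub>m N" "adj_mat A \<in> carrier_mat N N"
    using adj_mat[OF A(1)] by (auto intro!: eq_matI)
  then show ?thesis
    using A(1) by (auto simp: GL_def invertible_mat_def inverts_mat_def)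
qed

lemma jmat_1n_in_GL: "jmat_1n n u \<in> GL (n + 1)"
proof (rule upper_unitriangular_in_GL)
  show "upper_triangular (jmat_1n n u)"
    by (auto simp: index_jmat_1n)
qed (simp_all add: index_jmat_1n)

section \<open>Conjugation\<close>

text \<open>Conjugation by a constant matrix preserves exponentiality, so each reduction only has to
  bring \<open>A\<close> into \<open>S'\<close>.\<close>

lemma leadsto_exp_partI:
  assumes "S \<subseteq> carrier_mat N N"
    and "\<And>A. A \<in> S \<Longrightarrow> exponential A \<Longrightarrow> \<exists>P\<in>carrier_mat N N. \<exists>Q\<in>carrier_mat N N.
      P * Q = 1\<^sub>m N \<and> Q * P = 1\<^sub>m N \<and> const_mat Q * A * const_mat P \<in> S'"
  shows "leadsto N (exp_part S) (exp_part S')"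
  unfolding leadsto_def
proof
  fix A assume "A \<in> exp_part S"
  then have A: "A \<in> S" "exponential A" "A \<in> carrier_mat N N"
    using assms(1) by (auto simp: exp_part_def)
  then obtain P Q where PQ: "P \<in> carrier_mat N N" "Q \<in> carrier_mat N N" "P * Q = 1\<^sub>m N"
    "Q * P = 1\<^sub>m N" "const_mat Q * A * const_mat P \<in> S'"
    using assms(2) by blast
  then have "inverts_mat P Q" "inverts_mat Q P" "P \<in> GL N"
    by (auto simp: inverts_mat_def GL_def invertible_mat_def)
  moreover have "const_mat Q * A * const_mat P \<in> exp_part S'"
    using exponential_conj[OF A(2,3) PQ(1-4)] PQ(5) by (simp add: exp_part_def)
  ultimately show "\<exists>P\<in>GL N. \<exists>Q\<in>carrier_mat N N. inverts_mat P Q \<and> inverts_mat Q P \<and>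
      const_mat Q * A * const_mat P \<in> exp_part S'"
    using PQ by blast
qed

lemma ex_conj_one:
  fixes A :: "'a::comm_ring_1 poly mat"
  assumes "A \<in> carrier_mat N N" "A \<in> S'"
  shows "\<exists>P\<in>carrier_mat N N. \<exists>Q\<in>carrier_mat N N.
      P * Q = 1\<^sub>m N \<and> Q * P = 1\<^sub>m N \<and> const_mat Q * A * const_mat P \<in> S'"
proof -
  have "const_mat (1\<^sub>m N) = (1\<^sub>m N :: 'a poly mat)" by (intro eq_matI) auto
  then show ?thesis using assms by (intro bexI[of _ "1\<^sub>m N"]) auto
qed

section \<open>From unitriangular matrices with regular superdiagonal to the Toeplitz shape\<close>

lemma U1_coeff_mat:
  assumes A: "A \<in> U1 n" and "l > 0" "n \<ge> 1"
  shows "coeff_mat l A \<in> carrier_mat (n + 1) (n + 1)" "strict_upper (coeff_mat l A)"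
    "coeff_mat l A $$ (0, 1) = 0"
proof -
  \<comment> \<open>The diagonal entries of \<open>A\<close> are the constant 1, which has no
    coefficient in positive degree.\<close>
  have "coeff (A $$ (i, j)) l = 0" if "j \<le> i" "i < n + 1" for i j
    using that A assms(2) by (cases "i = j") (auto simp: U1_def upper_triangular_def)
  then show "coeff_mat l A \<in> carrier_mat (n + 1) (n + 1)" "strict_upper (coeff_mat l A)"
    "coeff_mat l A $$ (0, 1) = 0"
    using A assms(3) by (auto simp: U1_def strict_upper_def)
qed

text \<open>Commutation gives \<open>a\<^sub>i(T) a\<^sub>i\<^sub>+\<^sub>1(T') = a\<^sub>i(T') a\<^sub>i\<^sub>+\<^sub>1(T)\<close> for consecutive superdiagonal
  entries, so the support of the first nonzero one propagates down the superdiagonal.\<close>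

lemma U1_regular_coeff:
  fixes A :: "'a::field poly mat"
  assumes A: "A \<in> U1 n" "exponential A" and n: "n \<ge> 2"
  obtains m where "m > 0" "\<And>i. i \<in> {1..<n} \<Longrightarrow> coeff_mat m A $$ (i, i + 1) \<noteq> 0"
proof -
  have car: "A \<in> carrier_mat (n + 1) (n + 1)" using A by (simp add: U1_def)
  \<comment> \<open>The coefficient matrix in degree 0 is the identity and has no superdiagonal
    entries.\<close>
  have pos: "l > 0" if "coeff_mat l A $$ (i, i + 1) \<noteq> 0" "i < n" for l i
    using that A(2) car by (cases "l = 0") (auto simp: exponential_iff_coeff_mat[OF car] simp del: index_coeff_mat)
  have ex: "\<exists>l. coeff_mat l A $$ (i, i + 1) \<noteq> 0" if "i \<in> {1..<n}" for i
  proof -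
    have "\<forall>k\<in>{2..n}. A $$ (k - 1, k) \<noteq> 0"
      using A by (simp add: U1_def)
    then have "A $$ (i, i + 1) \<noteq> 0" using that by (auto dest!: bspec[of _ _ "i + 1"])
    then show ?thesis using that car by (auto simp: poly_eq_iff)
  qed
  obtain m where m: "coeff_mat m A $$ (1, 1 + 1) \<noteq> 0" using ex[of 1] n by auto
  then have m0: "m > 0" using pos n by auto
  have "coeff_mat m A $$ (i, i + 1) \<noteq> 0" if "1 \<le> i" "i < n" for i
    using that
  proof (induction i rule: dec_induct)
    case base
    then show ?case using m by simp
  next
    case (step i)
    obtain l where l: "coeff_mat l A $$ (i + 1, i + 1 + 1) \<noteq> 0" using ex[of "i + 1"] step by auto
    then have l0: "l > 0" using pos step by auto
    \<comment> \<open>The right-hand side is nonzero by the induction hypothesis and the choice of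
      \<open>l\<close>, so the factor of degree \<open>m\<close> on the left is nonzero as
      well.\<close>
    have "coeff_mat l A $$ (i, i + 1) * coeff_mat m A $$ (i + 1, i + 2)
      = coeff_mat m A $$ (i, i + 1) * coeff_mat l A $$ (i + 1, i + 2)"
      using coeff_mat_commute[OF A(2) car, of l m] step(4) n
        strict_upper_mult_second_diag[OF U1_coeff_mat(1,2)[OF A(1) l0] U1_coeff_mat(1,2)[OF A(1) m0], of i]
        strict_upper_mult_second_diag[OF U1_coeff_mat(1,2)[OF A(1) m0] U1_coeff_mat(1,2)[OF A(1) l0], of i]
      by simp
    then show ?case using l step by auto
  qed
  then show ?thesis using that m0 by auto
qed

text \<open>One coefficient matrix of \<open>A\<close> is similar to \<open>shift_mat n\<close>.
  Conjugating all of \<open>A\<close> by the same \<open>P\<close> makes every coefficient matrix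
  commute with \<open>shift_mat n\<close>, and \<open>shift_mat_commutant\<close> gives the
  shape.\<close>

lemma U1_conj_J1n:
  fixes A :: "'a::field poly mat"
  assumes A: "A \<in> U1 n" "exponential A" and n: "n \<ge> 2"
  obtains P Q where "P \<in> carrier_mat (n + 1) (n + 1)" "Q \<in> carrier_mat (n + 1) (n + 1)"
    "P * Q = 1\<^sub>m (n + 1)" "Q * P = 1\<^sub>m (n + 1)" "const_mat Q * A * const_mat P \<in> J1n n"
proof -
  let ?N = "n + 1"
  have car: "A \<in> carrier_mat ?N ?N" using A by (simp add: U1_def)
  obtain m where m: "m > 0" "\<And>i. i \<in> {1..<n} \<Longrightarrow> coeff_mat m A $$ (i, i + 1) \<noteq> 0"
    using U1_regular_coeff[OF A n] by blast
  have n1: "n \<ge> 1" using n by simp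
  obtain P Q where P: "P \<in> carrier_mat ?N ?N" and Q: "Q \<in> carrier_mat ?N ?N"
    and PQ: "P * Q = 1\<^sub>m ?N" "Q * P = 1\<^sub>m ?N" and up: "upper_triangular P"
    and shift: "Q * coeff_mat m A * P = shift_mat n"
    using strict_upper_similar_shift_mat[OF n1 U1_coeff_mat[OF A(1) m(1) n1] m(2)] by blast
  define B where "B = const_mat Q * A * const_mat P"
  have B: "B \<in> carrier_mat ?N ?N" using P Q car by (auto simp: B_def)
  have expB: "exponential B"
    unfolding B_def using A(2) car P Q PQ by (rule exponential_conj)
  have coeffB: "coeff_mat l B = Q * coeff_mat l A * P" for l
    unfolding B_def using Q car P by (rule coeff_mat_conj)
  \<comment> \<open>As \<open>P\<close> is upper triangular, its columns 0 and 1 lie in the span of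
    the first two basis vectors, which every \<open>coeff_mat l A\<close> with \<open>l > 0\<close>
    kills.\<close>
  have col: "coeff_mat l B $$ (i, j) = 0" if l: "l > 0" and i: "i \<le> n" and j: "j = 0 \<or> j = 1" for l i j
  proof -
    note C = U1_coeff_mat[OF A(1) l n1]
    have "(coeff_mat l A * P) $$ (k, j) = 0" if k: "k \<le> n" for k
    proof -
      have "(coeff_mat l A * P) $$ (k, j) = (\<Sum>r<?N. coeff_mat l A $$ (k, r) * P $$ (r, j))"
        using C P k j n by (intro index_mult_mat_sum[where n = ?N and k = ?N]) auto
      also have "coeff_mat l A $$ (k, r) * P $$ (r, j) = 0" if "r < ?N" for r
      proof (cases "r > j")
        case True
        then show ?thesis using up P that by (auto simp: upper_triangular_def)
      next
        case False
        then have "r \<le> k \<or> k = 0 \<and> r = 1" using j by auto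
        then have "coeff_mat l A $$ (k, r) = 0"
          using strict_upperD[OF C(2,1), of k r] C(3) k j that
          by (auto simp del: index_coeff_mat)
        then show ?thesis by simp
      qed
      then have "(\<Sum>r<?N. coeff_mat l A $$ (k, r) * P $$ (r, j)) = 0"
        by (intro sum.neutral) blast
      finally show ?thesis .
    qed
    moreover have "coeff_mat l B = Q * (coeff_mat l A * P)"
      unfolding coeffB using Q P C by (simp add: assoc_mult_mat[of _ ?N ?N _ ?N _ ?N])
    moreover have "(Q * (coeff_mat l A * P)) $$ (i, j)
        = (\<Sum>k<?N. Q $$ (i, k) * (coeff_mat l A * P) $$ (k, j))"
      using Q P C i j n by (intro index_mult_mat_sum[where n = ?N and k = ?N]) auto
    ultimately show ?thesis by (simp del: index_mult_mat(1) index_coeff_mat)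
  qed
  \<comment> \<open>The polynomial with index \<open>n\<close> sits in the corner of row 0, the
    others in the first row of the block; for \<open>k = n\<close> the column \<open>k + 1\<close>
    would lie outside the matrix.\<close>
  define u where "u k = (if k = n then B $$ (0, n) else B $$ (1, k + 1))" for k
  have "B = jmat_1n n u"
  proof (rule eq_matI)
    fix i j assume "i < dim_row (jmat_1n n u)" "j < dim_col (jmat_1n n u)"
    then have ij: "i \<le> n" "j \<le> n" using jmat_1n_carrier[of n u] by auto
    have ne: "j - i \<noteq> n" if "i > 0" using that ij by auto
    show "B $$ (i, j) = jmat_1n n u $$ (i, j)"
    proof (rule poly_eqI)
      fix l
      show "coeff (B $$ (i, j)) l = coeff (jmat_1n n u $$ (i, j)) l"
      proof (cases "l = 0")
        case True
        \<comment> \<open>Degree 0 is separate: the coefficient matrix is the identity there, whose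
          columns 0 and 1 do not vanish.\<close>
        have "coeff (B $$ (i, j)) 0 = (if i = j then 1 else 0)" if "i \<le> n" "j \<le> n" for i j
        proof -
          have "coeff_mat 0 B $$ (i, j) = 1\<^sub>m ?N $$ (i, j)"
            using expB by (simp add: exponential_iff_coeff_mat[OF B])
          then show ?thesis using B that by simp
        qed
        then show ?thesis using True ij n ne by (auto simp: index_jmat_1n u_def)
      next
        case False
        then have l: "l > 0" by simp
        have "coeff_mat m B = shift_mat n" using shift coeffB by simp
        then have comm: "coeff_mat l B * shift_mat n = shift_mat n * coeff_mat l B"
          using coeff_mat_commute[OF expB B, of l m] by simp
        have "coeff_mat l B $$ (i, j) = (if i = 0 then if j = n then coeff_mat l B $$ (0, n) else 0
            else if i < j then coeff_mat l B $$ (1, j - i + 1) else 0)"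
          using col[OF l] B n1 ij comm by (intro shift_mat_commutant) (auto simp del: index_coeff_mat)
        then show ?thesis using B ij n l ne by (auto simp: index_jmat_1n u_def)
      qed
    qed
  qed (use B in auto)
  moreover have "u 1 \<noteq> 0"
  proof -
    \<comment> \<open>The coefficient of \<open>u 1\<close> in degree \<open>m\<close> is an entry 1
      of \<open>shift_mat n\<close>.\<close>
    have "coeff_mat m B $$ (1, 2) = shift_mat n $$ (1, 2)" using shift coeffB by simp
    then have "coeff (B $$ (1, 2)) m = 1" using n B by (simp add: shift_mat_def)
    then show ?thesis using n by (auto simp: u_def numeral_2_eq_2)
  qed
  ultimately have "B \<in> J1n n"
    using n jmat_1n_in_GL[of n u] by (auto simp: J1n_def)
  then show ?thesis using that P Q PQ by (simp add: B_def)
qed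

section \<open>Conjugation by shears and by permutations\<close>

lemma ex_conj_shear:
  fixes A :: "'a::comm_ring_1 poly mat"
  assumes A: "A \<in> carrier_mat N N" and kl: "k < N" "l < N" "k \<noteq> l"
  shows "\<exists>P\<in>carrier_mat N N. \<exists>Q\<in>carrier_mat N N. P * Q = 1\<^sub>m N \<and> Q * P = 1\<^sub>m N \<and>
    const_mat Q * A * const_mat P = add_col_sub_row [:c:] k l A"
proof (intro bexI conjI)
  have const: "const_mat (addrow_mat N d k l) = addrow_mat N [:d:] k l" for d :: 'a
    using kl by (intro eq_matI) auto
  \<comment> \<open>The conjugating matrix is the identity with an extra \<open>c\<close> at
    \<open>(k, l)\<close>: column \<open>l\<close> gains \<open>c\<close> times column
    \<open>k\<close>, then row \<open>k\<close> loses \<open>c\<close> times row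
    \<open>l\<close>.\<close>
  have "add_col_sub_row [:c:] k l A = addrow (- [:c:]) k l (A * addrow_mat N [:c:] k l)"
    by (simp only: add_col_sub_row_def addcol_mat[OF A kl(1)])
  also have "\<dots> = addrow_mat N (- [:c:]) k l * (A * addrow_mat N [:c:] k l)"
    using A by (intro addrow_mat[of _ _ N] kl(2)) (auto intro!: mult_carrier_mat)
  also have "\<dots> = const_mat (addrow_mat N (- c) k l) * A * const_mat (addrow_mat N c k l)"
    using A by (simp add: const assoc_mult_mat[of _ N N _ N _ N])
  finally show "const_mat (addrow_mat N (- c) k l) * A * const_mat (addrow_mat N c k l)
    = add_col_sub_row [:c:] k l A" by simp
  show "addrow_mat N c k l * addrow_mat N (- c) k l = 1\<^sub>m N"
    using kl by (rule addrow_mat_inv)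
  show "addrow_mat N (- c) k l * addrow_mat N c k l = 1\<^sub>m N"
    using addrow_mat_inv[OF kl, of "- c"] by simp
qed auto

lemma ex_conj_permutation:
  fixes A :: "'a::field poly mat"
  assumes A: "A \<in> carrier_mat N N" and inj: "inj_on \<sigma> {..<N}" and ran: "\<sigma> ` {..<N} \<subseteq> {..<N}"
  shows "\<exists>P\<in>carrier_mat N N. \<exists>Q\<in>carrier_mat N N. P * Q = 1\<^sub>m N \<and> Q * P = 1\<^sub>m N \<and>
    const_mat Q * A * const_mat P = mat N N (\<lambda>(i, j). A $$ (\<sigma> i, \<sigma> j))"
proof -
  define P where "P = mat N N (\<lambda>(i, j). if i = \<sigma> j then 1 else (0::'a))"
  define Q where "Q = mat N N (\<lambda>(i, j). if j = \<sigma> i then 1 else (0::'a))"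
  have P: "P \<in> carrier_mat N N" and Q: "Q \<in> carrier_mat N N"
    by (simp_all add: P_def Q_def)
  have lt: "\<sigma> i < N" if "i < N" for i using ran that by auto
  have QP: "Q * P = 1\<^sub>m N"
  proof (rule eq_matI, goal_cases)
    case (1 i j)
    then have ij: "i < N" "j < N" by auto
    have "(Q * P) $$ (i, j) = (\<Sum>l<N. Q $$ (i, l) * P $$ (l, j))"
      using P Q ij by (intro index_mult_mat_sum)
    also have "\<dots> = (\<Sum>l<N. if l = \<sigma> i then if \<sigma> i = \<sigma> j then 1 else 0 else 0)"
      using ij by (intro sum.cong) (auto simp: P_def Q_def)
    finally show ?case using ij lt inj by (auto simp: inj_on_eq_iff)
  qed (use P Q in auto)
  have PQ: "P * Q = 1\<^sub>m N"
    using Q P QP by (rule mat_mult_left_right_inverse)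
  have QA: "const_mat Q * A = mat N N (\<lambda>(i, j). A $$ (\<sigma> i, j))"
  proof (rule eq_matI, goal_cases)
    case (1 i j)
    then have ij: "i < N" "j < N" by auto
    have "(const_mat Q * A) $$ (i, j) = (\<Sum>l<N. const_mat Q $$ (i, l) * A $$ (l, j))"
      using A Q ij by (intro index_mult_mat_sum) auto
    also have "\<dots> = (\<Sum>l<N. if l = \<sigma> i then A $$ (\<sigma> i, j) else 0)"
      using ij by (intro sum.cong) (auto simp: Q_def)
    finally show ?case using ij lt by auto
  qed (use A Q in auto)
  have "const_mat Q * A * const_mat P = mat N N (\<lambda>(i, j). A $$ (\<sigma> i, \<sigma> j))"
  proof (rule eq_matI, goal_cases)
    case (1 i j)
    then have ij: "i < N" "j < N" by auto
    have "(const_mat Q * A * const_mat P) $$ (i, j)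
        = (\<Sum>l<N. (const_mat Q * A) $$ (i, l) * const_mat P $$ (l, j))"
      using A P Q ij by (intro index_mult_mat_sum) auto
    also have "\<dots> = (\<Sum>l<N. if l = \<sigma> j then A $$ (\<sigma> i, \<sigma> j) else 0)"
      unfolding QA using ij by (intro sum.cong) (auto simp: P_def)
    finally show ?case using ij lt by auto
  qed (use A P Q in auto)
  then show ?thesis using P Q PQ QP by blast
qed

section \<open>The reductions\<close>

lemma U1_leadsto_J1n:
  assumes n: "n \<ge> 1"
  shows "leadsto (n + 1) (exp_part (U1 n :: 'a::field poly mat set)) (exp_part (J1n n))"
proof (rule leadsto_exp_partI)
  fix A :: "'a poly mat"
  assume A: "A \<in> U1 n" "exponential A"
  show "\<exists>P\<in>carrier_mat (n + 1) (n + 1). \<exists>Q\<in>carrier_mat (n + 1) (n + 1).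
      P * Q = 1\<^sub>m (n + 1) \<and> Q * P = 1\<^sub>m (n + 1) \<and> const_mat Q * A * const_mat P \<in> J1n n"
  proof (cases "n = 1")
    case True
    \<comment> \<open>For \<open>n = 1\<close> the only off-diagonal entry not below the diagonal is
      \<open>(0, 1)\<close>, which is 0 by definition of \<open>U1\<close>, so \<open>A\<close> is
      the identity.\<close>
    have "A $$ (1, 0) = 0"
      using A True by (auto simp: U1_def upper_triangular_def)
    then have "A = 1\<^sub>m 2"
      using A True by (intro eq_matI) (auto simp: U1_def less_Suc_eq numeral_2_eq_2)
    then show ?thesis using True by (intro ex_conj_one) (auto simp: J1n_def numeral_2_eq_2)
  next
    case False
    then show ?thesis using U1_conj_J1n[OF A] n by (metis One_nat_def Suc_leI le_neq_implies_less numeral_2_eq_2)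
  qed
qed (auto simp: U1_def)

lemma J1n_carrier: "J1n n \<subseteq> carrier_mat (n + 1) (n + 1)"
  by (auto simp: J1n_def numeral_2_eq_2)

lemma exp_part_Un: "exp_part (S \<union> S') = exp_part S \<union> exp_part S'"
  by (auto simp: exp_part_def)

text \<open>If \<open>u 1\<close> and \<open>u n\<close> are dependent, then \<open>u n\<close> is a
  scalar multiple of \<open>u 1\<close>, and a shear clears it from the corner.\<close>

lemma J1n_leadsto_J1n_0_1:
  assumes n: "n \<ge> 1"
  shows "leadsto (n + 1) (exp_part (J1n n :: 'a::field poly mat set))
    (exp_part (J1n_0 n) \<union> exp_part (J1n_1 n))"
  unfolding exp_part_Un[symmetric]
proof (rule leadsto_exp_partI[OF J1n_carrier])
  let ?N = "n + 1"
  fix A :: "'a poly mat"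
  assume "A \<in> J1n n"
  then consider "n = 1" "A \<in> J1n_0 n" | "n \<ge> 2" "A \<in> J1n_1 n" | u a b where "n \<ge> 2" "A = jmat_1n n u"
    "u 1 \<noteq> 0" "smult a (u 1) + smult b (u n) = 0" "a \<noteq> 0 \<or> b \<noteq> 0"
    using n by (cases "n = 1") (auto simp: J1n_def J1n_0_def J1n_1_def)
  then show "\<exists>P\<in>carrier_mat ?N ?N. \<exists>Q\<in>carrier_mat ?N ?N.
      P * Q = 1\<^sub>m ?N \<and> Q * P = 1\<^sub>m ?N \<and> const_mat Q * A * const_mat P \<in> J1n_0 n \<union> J1n_1 n"
  proof cases
    case 1
    then show ?thesis
      by (intro ex_conj_one) (auto simp: J1n_0_def numeral_2_eq_2)
  next
    case 2
    then show ?thesis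
      by (intro ex_conj_one) (auto simp: J1n_1_def)
  next
    case 3
    define c where "c = - a / b"
    \<comment> \<open>With \<open>b = 0\<close> the relation would read
      \<open>smult a (u 1) = 0\<close> and force \<open>a = 0\<close> too.\<close>
    have "b \<noteq> 0" using 3 by auto
    have "u n = smult (inverse b) (smult b (u n))" using \<open>b \<noteq> 0\<close> by simp
    also have "smult b (u n) = - smult a (u 1)" using 3(4) by (simp add: add_eq_0_iff)
    finally have un: "u n = [:c:] * u 1" by (simp add: c_def divide_inverse mult.commute)
    let ?v = "u(n := 0)"
    \<comment> \<open>Row \<open>n - 1\<close> has only the entries 1 and \<open>u 1\<close>, in the
      last two columns. Subtracting \<open>c\<close> times it from row 0 clears the corner, and the
      \<open>- c\<close> that it leaves in column \<open>n - 1\<close> cancels against the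
      \<open>c\<close> coming from column 0.\<close>
    have "add_col_sub_row [:c:] 0 (n - 1) A = jmat_1n n ?v"
    proof (rule eq_matI)
      fix i j assume "i < dim_row (jmat_1n n ?v)" "j < dim_col (jmat_1n n ?v)"
      then have ij: "i \<le> n" "j \<le> n" by auto
      then have "add_col_sub_row [:c:] 0 (n - 1) (jmat_1n n u) $$ (i, j) = jmat_1n n ?v $$ (i, j)"
        using 3(1) un
        by (subst add_col_sub_index_row) (auto simp: index_jmat_1n)
      then show "add_col_sub_row [:c:] 0 (n - 1) A $$ (i, j) = jmat_1n n ?v $$ (i, j)"
        using 3 by simp
    qed (use 3 in auto)
    moreover have "jmat_1n n ?v \<in> J1n_0 n"
      using 3 jmat_1n_in_GL[of n ?v] by (auto simp: J1n_0_def intro!: exI[of _ ?v])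
    moreover have "A \<in> carrier_mat ?N ?N" "0 < ?N" "n - 1 < ?N" "0 \<noteq> n - 1"
      using 3(1,2) by auto
    ultimately show ?thesis
      using ex_conj_shear[of A ?N 0 "n - 1" c] by (metis UnI1)
  qed
qed

text \<open>With \<open>u n = 0\<close> the matrix is block diagonal, and reordering the basis
  exchanges the two blocks.\<close>

lemma J1n_0_1_leadsto_Jn1_0_1:
  assumes n: "n \<ge> 1"
  shows "leadsto (n + 1) (exp_part (J1n_0 n :: 'a::field poly mat set) \<union> exp_part (J1n_1 n))
    (exp_part (Jn1_0 n) \<union> exp_part (J1n_1 n))"
  unfolding exp_part_Un[symmetric]
proof (rule leadsto_exp_partI)
  let ?N = "n + 1"
  show car: "J1n_0 n \<union> J1n_1 n \<subseteq> carrier_mat ?N ?N"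
    by (auto simp: J1n_0_def J1n_1_def numeral_2_eq_2)
  fix A :: "'a poly mat"
  assume A: "A \<in> J1n_0 n \<union> J1n_1 n"
  then consider "A \<in> Jn1_0 n \<union> J1n_1 n" | u where "n \<ge> 2" "A = jmat_1n n u" "u 1 \<noteq> 0" "u n = 0"
    using n by (cases "n = 1") (auto simp: J1n_0_def Jn1_0_def J1n_1_def)
  then show "\<exists>P\<in>carrier_mat ?N ?N. \<exists>Q\<in>carrier_mat ?N ?N.
      P * Q = 1\<^sub>m ?N \<and> Q * P = 1\<^sub>m ?N \<and> const_mat Q * A * const_mat P \<in> Jn1_0 n \<union> J1n_1 n"
  proof cases
    case 1
    then show ?thesis using A car by (intro ex_conj_one) auto
  next
    case 2
    \<comment> \<open>This cyclic shift puts the basis vector 0 last and keeps the order of the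
      others.\<close>
    define \<sigma> where "\<sigma> i = (if i = n then 0 else Suc i)" for i
    have car_A: "A \<in> carrier_mat ?N ?N" using A car by blast
    have inj: "inj_on \<sigma> {..<?N}" and ran: "\<sigma> ` {..<?N} \<subseteq> {..<?N}"
      by (auto simp: \<sigma>_def inj_on_def)
    have "mat ?N ?N (\<lambda>(i, j). A $$ (\<sigma> i, \<sigma> j)) = jmat_n1 n u"
      using 2 by (intro eq_matI) (auto simp: \<sigma>_def index_jmat_1n index_jmat_n1)
    moreover have "jmat_n1 n u \<in> Jn1_0 n"
      using 2 by (auto simp: Jn1_0_def)
    ultimately show ?thesis
      using ex_conj_permutation[OF car_A inj ran] by (metis UnI1)
  qed
qed

text \<open>From row 1 on, the superdiagonal of a coefficient matrix is constant, equal to a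
  coefficient of \<open>u 1\<close>. If that coefficient is nonzero, the entry
  \<open>(1, 1 + p)\<close> of the \<open>p\<close>-th power is its \<open>p\<close>-th power; this
  position lies inside the matrix exactly when \<open>n > p\<close>.\<close>

lemma exp_part_J1n_empty:
  assumes p: "CHAR('a::field) > 0" and n: "n > CHAR('a)"
  shows "exp_part (J1n n :: 'a poly mat set) = {}"
proof (rule ccontr)
  assume "exp_part (J1n n :: 'a poly mat set) \<noteq> {}"
  then obtain A :: "'a poly mat" where A: "A \<in> J1n n" "exponential A"
    by (auto simp: exp_part_def)
  have "n \<ge> 2" using p n by simp
  then obtain u where u: "A = jmat_1n n u" "u 1 \<noteq> 0"
    using A(1) by (auto simp: J1n_def)
  have car: "A \<in> carrier_mat (Suc n) (Suc n)" by (simp add: u)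
  obtain m where m: "coeff (u 1) m \<noteq> 0" using u(2) by (auto simp: poly_eq_iff)
  define M where "M = coeff_mat m A"
  have M: "M \<in> carrier_mat (Suc n) (Suc n)" using car by (simp add: M_def)
  have M1: "M $$ (i, i + 1) = coeff (u 1) m" if "1 \<le> i" "i < n" for i
    using that by (simp add: M_def u index_jmat_1n)
  have m0: "m > 0"
  proof (rule ccontr)
    assume "\<not> m > 0"
    then have "M = 1\<^sub>m (Suc n)"
      using A(2) by (simp add: M_def exponential_iff_coeff_mat[OF car])
    then show False using M1[of 1] \<open>n \<ge> 2\<close> m by simp
  qed
  have "strict_upper M"
    using m0 by (auto simp: strict_upper_def M_def u index_jmat_1n)
  then have "(M ^\<^sub>m CHAR('a)) $$ (1, 1 + CHAR('a)) = (\<Prod>l<CHAR('a). M $$ (1 + l, 1 + l + 1))"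
    using M n by (intro strict_upper_pow_diag) auto
  also have "\<dots> \<noteq> 0"
    using M1 m n by (auto simp: prod_zero_iff)
  finally show False
    using coeff_mat_pow_char[OF A(2) car m0 p] n by (simp add: M_def)
qed

theorem corollary1p26:
  fixes p n :: nat
  assumes "CHAR('k::field) = p" and "p > 0" and "n \<ge> 1"
  shows "(n \<le> p \<longrightarrow>
            leadsto (n + 1) (exp_part (U1 n :: 'k poly mat set)) (exp_part (J1n n)) \<and>
            leadsto (n + 1) (exp_part (J1n n :: 'k poly mat set))
              (exp_part (J1n_0 n) \<union> exp_part (J1n_1 n)) \<and>
            leadsto (n + 1) (exp_part (J1n_0 n :: 'k poly mat set) \<union> exp_part (J1n_1 n))
              (exp_part (Jn1_0 n) \<union> exp_part (J1n_1 n))) \<and>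
         (n > p \<longrightarrow> exp_part (J1n n :: 'k poly mat set) = {})"
  using U1_leadsto_J1n[OF assms(3)] J1n_leadsto_J1n_0_1[OF assms(3)]
    J1n_0_1_leadsto_Jn1_0_1[OF assms(3)] exp_part_J1n_empty assms(1,2)
  by blast

end
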